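(* Let $q\in(0,1)$. If $f(z)=z+\sum_{n=2}^\infty a_nz^n$ belongs to $\mathcal{K}_q$ with the function $g(z)=z/(1-z+z^2)$, then for all $m\ge 1$ $$|a_n|\le\begin{cases}\dfrac{1-q}{1-q^n}\left(\dfrac13(2-q)+\dfrac{2n}{3}(1+q)\right), & \text{if } n=3m-1,\\[3mm] \dfrac{1-q^2}{1-q^n}\,\dfrac{2n}{3}, & \text{if } n=3m,\\[3mm] \dfrac{1-q}{1-q^n}\left(\dfrac{2n}{3}(1+q)+\dfrac13(1-2q)\right), & \text{if } n=3m+1.\end{cases}$$
   Context: $\mathbb{D}=\{z\in\mathbb{C}:|z|<1\}$. $\mathcal{A}$ is the class of functions $f$ analytic in $\mathbb{D}$ with $f(0)=0=f'(0)-1$. $\mathcal{S}^*\subset\mathcal{A}$ is the class of univalent functions $g\in\mathcal{A}$ that are starlike with respect to the origin. For $q\in(0,1)$ and $f\in\mathcal{A}$, the $q$-difference operator is $(D_qf)(z)=\dfrac{f(z)-f(qz)}{z(1-q)}$ for $z\in\mathbb{D}\setminus\{0\}$, and $(D_qf)(0)=f'(0)$. A function $f\in\mathcal{A}$ belongs to $\mathcal{K}_q$ if there exists $g\in\mathcal{S}^*$ such that $$\left|\frac{z}{g(z)}(D_qf)(z)-\frac{1}{1-q}\right|\le\frac{1}{1-q},\quad z\in\mathbb{D}$$ (where $z/g(z)$ is given its limit value $1$ at $z=0$); one then says that $f\in\mathcal{K}_q$ with the function $g$. *)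

theory Defs
  imports "HOL-Complex_Analysis.Complex_Analysis"
begin

abbreviation unit_disc :: "complex set" where
  "unit_disc \<equiv> ball 0 1"

definition class_A :: "(complex \<Rightarrow> complex) set" where
  "class_A = {f. f analytic_on unit_disc \<and> f 0 = 0 \<and> deriv f 0 = 1}"

(* The library predicate starlike leaves the centre existentially quantified,
   so starlikeness with respect to the origin is written out. *)
definition class_S_star :: "(complex \<Rightarrow> complex) set" where
  "class_S_star = {g \<in> class_A. inj_on g unit_disc \<and>
     (\<forall>w \<in> g ` unit_disc. closed_segment 0 w \<subseteq> g ` unit_disc)}"

definition q_diff :: "real \<Rightarrow> (complex \<Rightarrow> complex) \<Rightarrow> complex \<Rightarrow> complex" where
  "q_diff q f z =
     (if z = 0 then deriv f 0
      else (f z - f (of_real q * z)) / (z * (1 - of_real q)))"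

(* The value 1 at the origin is the limit of z / g z there, since g 0 = 0 and g' 0 = 1. *)
definition id_over :: "(complex \<Rightarrow> complex) \<Rightarrow> complex \<Rightarrow> complex" where
  "id_over g z = (if z = 0 then 1 else z / g z)"

definition in_Kq_with :: "real \<Rightarrow> (complex \<Rightarrow> complex) \<Rightarrow> (complex \<Rightarrow> complex) \<Rightarrow> bool" where
  "in_Kq_with q f g \<longleftrightarrow> f \<in> class_A \<and> g \<in> class_S_star \<and>
     (\<forall>z \<in> unit_disc.
        norm (id_over g z * q_diff q f z - 1 / (1 - of_real q)) \<le> 1 / (1 - q))"

definition Kq :: "real \<Rightarrow> (complex \<Rightarrow> complex) set" where
  "Kq q = {f. \<exists>g. in_Kq_with q f g}"

end

theory Submission
  imports Defs
begin

text \<open>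
  Put \<open>p\<^sub>k = a\<^sub>k\<^sub>+\<^sub>1 (1 - q^(k+1)) / (1 - q)\<close>, with \<open>a\<^sub>1 = 1\<close>. These are the Taylor
  coefficients of \<open>D\<^sub>q f\<close>, so the claim is a bound on \<open>p\<^sub>k\<close>. Since \<open>z / g(z) = 1 - z + z^2\<close>,
  membership in the class says that \<open>h(z) = (1 - z + z^2) (D\<^sub>q f)(z)\<close> takes its values in the
  closed disc of centre and radius \<open>1 / (1 - q)\<close>; equivalently,
  \<open>\<phi> = (1 - q) h - 1\<close> is bounded by 1 on the unit disc, and \<open>\<phi>(0) = -q\<close>.

  A function bounded by 1 has Taylor coefficients \<open>\<bar>\<phi>\<^sub>k\<bar> \<le> 1 - \<bar>\<phi>\<^sub>0\<bar>^2\<close> for \<open>k \<ge> 1\<close>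
  (\<open>bounded_coeff_bound\<close>), whence \<open>\<bar>h\<^sub>k\<bar> \<le> (1 - q^2) / (1 - q) = 1 + q\<close>.

  It remains to divide by \<open>1 - z + z^2\<close>. Because \<open>(1 + z)(1 - z + z^2) = 1 + z^3\<close>, the
  coefficients satisfy \<open>p\<^sub>k\<^sub>+\<^sub>3 + p\<^sub>k = h\<^sub>k\<^sub>+\<^sub>3 + h\<^sub>k\<^sub>+\<^sub>2\<close>, so that \<open>\<bar>p\<^sub>k\<bar>\<close> grows by at most
  \<open>2 (1 + q)\<close> over three steps (\<open>mod3_recurrence_bounds\<close>). The three residues of \<open>k\<close> modulo 3
  differ only in their starting values, and give the three cases of the claim.
\<close>

section \<open>Taylor coefficients of functions bounded by one\<close>

lemma norm_coeff_le_1_of_bounded: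
  fixes g :: "complex \<Rightarrow> complex"
  assumes hol: "g holomorphic_on ball 0 1"
    and bound: "\<And>z. z \<in> ball 0 1 \<Longrightarrow> norm (g z) \<le> 1"
    and exp: "g has_fps_expansion G"
  shows "norm (fps_nth G n) \<le> 1"
proof -
  have coeff: "fps_nth G n = (deriv ^^ n) g 0 / fact n"
    using fps_nth_fps_expansion[OF exp] .
  \<comment> \<open>Cauchy's inequality needs continuity up to the circle, so it is used on radius \<open>r < 1\<close>
    before letting \<open>r\<close> tend to 1.\<close>
  have scaled: "norm (fps_nth G n) * r ^ n \<le> 1" if r: "0 < r" "r < 1" for r :: real
  proof -
    have "norm ((deriv ^^ n) g 0) \<le> fact n * 1 / r ^ n"
    proof (rule Cauchy_inequality)
      show "g holomorphic_on ball 0 r"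
        using hol r by (auto elim: holomorphic_on_subset)
      show "continuous_on (cball 0 r) g"
        using r by (intro holomorphic_on_imp_continuous_on holomorphic_on_subset[OF hol]) auto
    qed (use r bound in auto)
    with r show ?thesis
      by (simp add: coeff norm_divide field_simps)
  qed
  have "((\<lambda>r. norm (fps_nth G n) * r ^ n) \<longlongrightarrow> norm (fps_nth G n) * 1 ^ n) (at_left (1::real))"
    by (intro tendsto_intros)
  moreover have "eventually (\<lambda>r::real. norm (fps_nth G n) * r ^ n \<le> 1) (at_left 1)"
    using eventually_at_left_real[of 0 1] by (rule eventually_mono) (use scaled in auto)
  ultimately show ?thesis
    by (intro tendsto_upperbound[where F = "at_left (1::real)" and a = 1]) auto
qed

text \<open>
  On the closed disc \<open>\<bar>c w\<bar> < 1\<close> excludes a pole, and the bound follows from the identity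
  \<open>\<bar>1 - cnj c w\<bar>^2 - \<bar>w - c\<bar>^2 = (1 - \<bar>w\<bar>^2) (1 - \<bar>c\<bar>^2)\<close>.
\<close>

lemma norm_Moebius_le_1:
  fixes w c :: complex
  assumes "norm w \<le> 1" "norm c < 1"
  shows "1 - cnj c * w \<noteq> 0" "norm ((w - c) / (1 - cnj c * w)) \<le> 1"
proof -
  have "norm (cnj c * w) \<le> norm c * 1"
    using assms by (simp only: norm_mult complex_mod_cnj) (intro mult_left_mono, auto)
  with assms have "norm (cnj c * w) < 1" by linarith
  then show nz: "1 - cnj c * w \<noteq> 0" by auto
  have "(norm (1 - cnj c * w))\<^sup>2 - (norm (w - c))\<^sup>2
      = (1 - (norm w)\<^sup>2) * (1 - (norm c)\<^sup>2)"
    unfolding cmod_power2 by (simp add: power2_eq_square algebra_simps)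
  also have "\<dots> \<ge> 0"
    using assms by (intro mult_nonneg_nonneg) (auto simp: abs_square_le_1 power_le_one)
  finally have "(norm (w - c))\<^sup>2 \<le> (norm (1 - cnj c * w))\<^sup>2"
    by (simp only: diff_ge_0_iff_ge)
  then have "norm (w - c) \<le> norm (1 - cnj c * w)"
    by (rule power2_le_imp_le) (rule norm_ge_zero)
  then show "norm ((w - c) / (1 - cnj c * w)) \<le> 1"
    using nz by (simp add: norm_divide divide_le_eq)
qed

text \<open>
  Suppose \<open>f(z) = c\<^sub>0 + c\<^sub>n z^n + \<dots>\<close>. The Moebius map that sends \<open>c\<^sub>0\<close> to 0 keeps the values in
  the unit disc, and its derivative at \<open>c\<^sub>0\<close> is \<open>1 / (1 - \<bar>c\<^sub>0\<bar>^2)\<close>. Composed with \<open>f\<close> it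
  therefore has the expansion \<open>c\<^sub>n / (1 - \<bar>c\<^sub>0\<bar>^2) z^n + \<dots>\<close>, to which the bound by 1 applies.
\<close>

lemma first_coeff_bound:
  fixes f :: "complex \<Rightarrow> complex" and c :: "nat \<Rightarrow> complex"
  assumes series: "\<And>z. z \<in> ball 0 1 \<Longrightarrow> (\<lambda>k. c k * z ^ k) sums f z"
    and bound: "\<And>z. z \<in> ball 0 1 \<Longrightarrow> norm (f z) \<le> 1"
    and c0: "norm (c 0) < 1" and n: "0 < n"
    and gap: "\<And>k. 0 < k \<Longrightarrow> k < n \<Longrightarrow> c k = 0"
  shows "norm (c n) \<le> 1 - (norm (c 0))\<^sup>2"
proof -
  define F where "F = Abs_fps c"
  define D where "D = 1 - fps_const (cnj (c 0)) * F"
  define G where "G = (F - fps_const (c 0)) / D"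
  define g where "g = (\<lambda>z. (f z - c 0) / (1 - cnj (c 0) * f z))"
  have hol: "f holomorphic_on ball 0 1"
    by (rule power_series_holomorphic[where a = c]) (use series in auto)
  have "eventually (\<lambda>z. z \<in> ball 0 1) (nhds (0::complex))"
    by (intro eventually_nhds_in_open) auto
  then have f_exp: "f has_fps_expansion F"
    unfolding F_def by (intro has_fps_expansionI) (auto elim!: eventually_mono intro: series)
  have D0: "fps_nth D 0 = of_real (1 - (norm (c 0))\<^sup>2)"
    unfolding of_real_diff complex_norm_square by (simp add: D_def F_def mult.commute)
  have pos: "1 - (norm (c 0))\<^sup>2 > 0"
    using c0 by (simp add: abs_square_less_1)
  then have D0_nz: "fps_nth D 0 \<noteq> 0"
    unfolding D0 of_real_eq_0_iff by simp
  have g_exp: "g has_fps_expansion G"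
    unfolding g_def G_def by (intro has_fps_expansion_divide' D0_nz)
      (auto simp: D_def intro!: fps_expansion_intros f_exp)
  have GD: "G * D = F - fps_const (c 0)"
    using D0_nz by (simp add: G_def fps_divide_unit mult.assoc inverse_mult_eq_1)
  \<comment> \<open>The coefficients of \<open>G\<close> up to order \<open>n\<close> are read off from the product \<open>G * D\<close>: in each
    convolution sum all terms but the last contain a coefficient of \<open>G\<close> already known to vanish.\<close>
  have conv: "(\<Sum>i=0..k. fps_nth G i * fps_nth D (k - i)) = (if k = 0 then 0 else c k)" for k
    using arg_cong[OF GD, of "\<lambda>S. fps_nth S k"] by (auto simp: fps_mult_nth F_def)
  have low: "fps_nth G k = 0" if "k < n" for k
    using that
  proof (induction k rule: less_induct)
    case (less k)
    have "(\<Sum>i=0..k. fps_nth G i * fps_nth D (k - i)) = fps_nth G k * fps_nth D 0"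
      using less by (subst sum.remove[where x = k]) (auto intro!: sum.neutral)
    with conv[of k] gap[of k] less.prems D0_nz show ?case by (auto split: if_splits)
  qed
  have "(\<Sum>i=0..n. fps_nth G i * fps_nth D (n - i)) = fps_nth G n * fps_nth D 0"
    using low by (subst sum.remove[where x = n]) (auto intro!: sum.neutral)
  with conv[of n] n have "c n = fps_nth G n * of_real (1 - (norm (c 0))\<^sup>2)"
    unfolding D0 by simp
  then have "norm (c n) = norm (fps_nth G n) * (1 - (norm (c 0))\<^sup>2)"
    using pos by (simp only: norm_mult norm_of_real abs_of_pos)
  moreover have "norm (fps_nth G n) \<le> 1"
  proof (rule norm_coeff_le_1_of_bounded[OF _ _ g_exp])
    show "g holomorphic_on ball 0 1"
      unfolding g_def using norm_Moebius_le_1(1)[OF bound c0]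
      by (intro holomorphic_intros hol) auto
    show "norm (g z) \<le> 1" if "z \<in> ball 0 1" for z
      unfolding g_def by (rule norm_Moebius_le_1(2)[OF bound[OF that] c0])
  qed
  ultimately show ?thesis
    using pos mult_right_mono[of "norm (fps_nth G n)" 1 "1 - (norm (c 0))\<^sup>2"] by simp
qed

text \<open>
  Averaging \<open>f\<close> over the rotations by \<open>n\<close>-th roots of unity (Wiener's device) preserves the bound
  by 1 and keeps exactly the coefficients whose index is a multiple of \<open>n\<close>. The average thus starts
  \<open>c\<^sub>0 + c\<^sub>n z^n + \<dots>\<close>, which reduces the claim to a function with a gap.
\<close>

lemma bounded_coeff_bound:
  fixes f :: "complex \<Rightarrow> complex" and c :: "nat \<Rightarrow> complex"
  assumes series: "\<And>z. z \<in> ball 0 1 \<Longrightarrow> (\<lambda>k. c k * z ^ k) sums f z"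
    and bound: "\<And>z. z \<in> ball 0 1 \<Longrightarrow> norm (f z) \<le> 1"
    and c0: "norm (c 0) < 1" and n: "0 < n"
  shows "norm (c n) \<le> 1 - (norm (c 0))\<^sup>2"
proof -
  define w where "w = exp (2 * of_real pi * \<i> * of_nat 1 / of_nat n)"
  \<comment> \<open>The factor by which the averaging multiplies the \<open>k\<close>-th coefficient.\<close>
  define s where "s = (\<lambda>k. (\<Sum>j<n. (w ^ k) ^ j) / of_nat n)"
  have w_pow: "w ^ k = exp (2 * of_real pi * \<i> * of_nat k / of_nat n)" for k
    unfolding w_def exp_of_nat_mult[symmetric] by (simp add: mult_ac)
  have w_eq_1: "w ^ k = 1 \<longleftrightarrow> n dvd k" for k
    unfolding w_pow using n by (intro complex_root_unity_eq_1) auto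
  have norm_w: "norm w = 1"
    by (simp add: w_def)
  have s_1: "s k = 1" if "n dvd k" for k
    using that n w_eq_1[of k] by (simp add: s_def)
  have s_0: "s k = 0" if "0 < k" "k < n" for k
  proof -
    have "w ^ k \<noteq> 1"
      using that by (auto simp: w_eq_1 dest: dvd_imp_le)
    moreover have "(w ^ k) ^ n = 1"
      by (simp add: w_eq_1 flip: power_mult)
    ultimately show ?thesis
      by (simp add: s_def geometric_sum)
  qed
  define g where "g = (\<lambda>z. (\<Sum>j<n. f (w ^ j * z)) / of_nat n)"
  have in_disc: "w ^ j * z \<in> ball 0 1" if "z \<in> ball 0 1" for j z
    using that norm_w by (simp add: norm_mult norm_power)
  have "norm (c n * s n) \<le> 1 - (norm (c 0 * s 0))\<^sup>2"
  proof (rule first_coeff_bound[where f = g])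
    fix z :: complex assume z: "z \<in> ball 0 1"
    have "(\<lambda>k. (\<Sum>j<n. c k * (w ^ j * z) ^ k) / of_nat n) sums g z"
      unfolding g_def by (intro sums_divide sums_sum series in_disc z)
    moreover have "(\<Sum>j<n. c k * (w ^ j * z) ^ k) / of_nat n = c k * s k * z ^ k" for k
      by (simp add: s_def sum_distrib_left sum_distrib_right power_mult_distrib mult_ac
               flip: power_mult)
    ultimately show "(\<lambda>k. c k * s k * z ^ k) sums g z" by simp
    have "norm (\<Sum>j<n. f (w ^ j * z)) \<le> of_nat (card {..<n}) * 1"
      by (rule sum_norm_bound) (intro bound in_disc z)
    then show "norm (g z) \<le> 1"
      using n by (simp add: g_def norm_divide divide_le_eq)
  qed (use c0 n s_1 s_0 in auto)
  then show ?thesis by (simp add: s_1)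
qed

section \<open>Division by \<open>1 - z + z^2\<close>\<close>

text \<open>
  The hypotheses bound the coefficients of positive index of \<open>(1 - z + z^2) \<Sum> p\<^sub>k z^k\<close>. Multiplying
  once more by \<open>1 + z\<close> adds neighbouring ones and leaves \<open>p\<^sub>k\<^sub>+\<^sub>3 + p\<^sub>k\<close>; estimating this sum,
  rather than each step of the recurrence of order two, keeps the growth linear.
\<close>

lemma mod3_recurrence_bounds:
  fixes p :: "nat \<Rightarrow> complex" and C :: real
  assumes p0: "norm (p 0) \<le> 1" and p1: "norm (p 1 - p 0) \<le> C"
    and rec: "\<And>k. norm (p (k + 2) - p (k + 1) + p k) \<le> C"
  shows "norm (p (3 * m)) \<le> 1 + 2 * real m * C"
    and "norm (p (3 * m + 1)) \<le> 1 + (2 * real m + 1) * C"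
    and "norm (p (3 * m + 2)) \<le> (2 * real m + 2) * C"
proof -
  have step: "norm (p (k + 3)) \<le> norm (p k) + 2 * C" for k
  proof -
    have triangle: "norm (u + v - x) \<le> norm u + norm v + norm x" for u v x :: complex
      by norm
    have "p (k + 3) = (p (k + 1 + 2) - p (k + 1 + 1) + p (k + 1)) + (p (k + 2) - p (k + 1) + p k) - p k"
      by (simp add: numeral_eq_Suc)
    then have "norm (p (k + 3)) \<le> norm (p (k + 1 + 2) - p (k + 1 + 1) + p (k + 1))
        + norm (p (k + 2) - p (k + 1) + p k) + norm (p k)"
      by (metis triangle)
    with rec[of "k + 1"] rec[of k] show ?thesis by linarith
  qed
  have iter: "norm (p (3 * m + i)) \<le> norm (p i) + 2 * real m * C" for i
  proof (induction m)
    case (Suc m)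
    have "norm (p (3 * Suc m + i)) \<le> norm (p (3 * m + i)) + 2 * C"
      using step[of "3 * m + i"] by (simp add: algebra_simps)
    with Suc show ?case by (simp add: algebra_simps)
  qed simp
  have "norm (p 1) \<le> 1 + C"
    using p0 p1 by norm
  moreover have "norm (p 2) \<le> 2 * C"
  proof -
    have "p 2 = (p (0 + 2) - p (0 + 1) + p 0) + (p 1 - p 0)" by (simp add: numeral_2_eq_2)
    then have "norm (p 2) \<le> norm (p (0 + 2) - p (0 + 1) + p 0) + norm (p 1 - p 0)"
      by (metis norm_triangle_ineq)
    with rec[of 0] p1 show ?thesis by linarith
  qed
  ultimately show "norm (p (3 * m)) \<le> 1 + 2 * real m * C"
    and "norm (p (3 * m + 1)) \<le> 1 + (2 * real m + 1) * C"
    and "norm (p (3 * m + 2)) \<le> (2 * real m + 2) * C"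
    using iter[of 0] iter[of 1] iter[of 2] p0 by (simp_all add: algebra_simps)
qed

section \<open>Power series of the \<open>q\<close>-difference operator\<close>

text \<open>
  On monomials the operator acts by \<open>D\<^sub>q z^n = (1 - q^n) / (1 - q) z^(n-1)\<close>. The origin needs a
  separate argument, as there the operator is the ordinary derivative.
\<close>

lemma q_diff_sums:
  fixes f :: "complex \<Rightarrow> complex" and b :: "nat \<Rightarrow> complex"
  assumes q: "0 < q" "q < 1"
    and series: "\<And>z. z \<in> ball 0 1 \<Longrightarrow> (\<lambda>k. b k * z ^ k) sums f z"
    and z: "z \<in> ball 0 1"
  shows "(\<lambda>k. b (Suc k) * of_real ((1 - q ^ Suc k) / (1 - q)) * z ^ k) sums q_diff q f z"
proof (cases "z = 0")
  case True
  have "eventually (\<lambda>z. z \<in> ball 0 1) (nhds (0::complex))"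
    by (intro eventually_nhds_in_open) auto
  then have "f has_fps_expansion Abs_fps b"
    by (intro has_fps_expansionI) (auto elim!: eventually_mono intro: series)
  then have "deriv f 0 = b 1"
    using fps_nth_fps_expansion[of f "Abs_fps b" 1] by simp
  moreover have "(\<lambda>k. b (Suc k) * of_real ((1 - q ^ Suc k) / (1 - q)) * 0 ^ k) sums b 1"
    using powser_sums_zero[of "\<lambda>k. b (Suc k) * of_real ((1 - q ^ Suc k) / (1 - q))"] q by simp
  ultimately show ?thesis
    using True by (simp add: q_diff_def)
next
  case False
  have "norm (of_real q * z) < 1"
    using z q mult_strict_mono[of q 1 "norm z" 1] by (simp add: norm_mult)
  then have "(\<lambda>k. b k * z ^ k - b k * (of_real q * z) ^ k) sums (f z - f (of_real q * z))"
    using z by (intro sums_diff series) auto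
  then have "(\<lambda>k. b (Suc k) * z ^ Suc k - b (Suc k) * (of_real q * z) ^ Suc k)
      sums (f z - f (of_real q * z))"
    by (subst sums_Suc_iff) simp
  then have "(\<lambda>k. (b (Suc k) * z ^ Suc k - b (Suc k) * (of_real q * z) ^ Suc k) / (z * (1 - of_real q)))
      sums q_diff q f z"
    using False unfolding q_diff_def by (simp only: if_False) (intro sums_divide)
  moreover have "(b (Suc k) * z ^ Suc k - b (Suc k) * (of_real q * z) ^ Suc k) / (z * (1 - of_real q))
      = b (Suc k) * of_real ((1 - q ^ Suc k) / (1 - q)) * z ^ k" for k
    using False q by (simp add: field_simps power_mult_distrib)
  ultimately show ?thesis by simp
qed

lemma sums_mult_var:
  fixes p :: "nat \<Rightarrow> complex"
  assumes "(\<lambda>k. p k * z ^ k) sums s"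
  shows "(\<lambda>k. (case k of 0 \<Rightarrow> 0 | Suc j \<Rightarrow> p j) * z ^ k) sums (z * s)"
  using sums_mult[OF assms, of z] 
  by (subst sums_Suc_iff[symmetric, where f = "\<lambda>k. (case k of 0 \<Rightarrow> 0 | Suc j \<Rightarrow> p j) * z ^ k", simplified])
     (simp add: mult_ac)

section \<open>The coefficient estimate\<close>

theorem corollary3p7:
  fixes q :: real and f :: "complex \<Rightarrow> complex" and a :: "nat \<Rightarrow> complex"
  assumes "0 < q" and "q < 1"
    and "\<And>z. z \<in> unit_disc \<Longrightarrow> (\<lambda>k. a (k + 2) * z ^ (k + 2)) sums (f z - z)"
    and "in_Kq_with q f (\<lambda>z. z / (1 - z + z ^ 2))"
  shows "\<forall>m n :: nat. m \<ge> 1 \<longrightarrow>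
    (n = 3 * m - 1 \<longrightarrow>
       norm (a n) \<le> (1 - q) / (1 - q ^ n) * (1 / 3 * (2 - q) + 2 * real n / 3 * (1 + q))) \<and>
    (n = 3 * m \<longrightarrow>
       norm (a n) \<le> (1 - q ^ 2) / (1 - q ^ n) * (2 * real n / 3)) \<and>
    (n = 3 * m + 1 \<longrightarrow>
       norm (a n) \<le> (1 - q) / (1 - q ^ n) * (2 * real n / 3 * (1 + q) + 1 / 3 * (1 - 2 * q)))"
proof -
  define b where "b k = (if k = 0 then 0 else if k = 1 then 1 else a k)" for k
  define p where "p k = b (Suc k) * of_real ((1 - q ^ Suc k) / (1 - q))" for k
  define shift where "shift u k = (case k of 0 \<Rightarrow> 0 | Suc j \<Rightarrow> u j)" for u :: "nat \<Rightarrow> complex" and k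
  \<comment> \<open>The coefficients of \<open>(1 - z + z^2) D\<^sub>q f\<close>: \<open>shift\<close> is multiplication by \<open>z\<close>.\<close>
  define h where "h k = p k - shift p k + shift (shift p) k" for k
  define \<phi> where "\<phi> k = of_real (1 - q) * h k - (if k = 0 then 1 else 0)" for k
  have f_sums: "(\<lambda>k. b k * z ^ k) sums f z" if "z \<in> ball 0 1" for z
  proof -
    have "(\<lambda>k. b (k + 2) * z ^ (k + 2)) sums (f z - (\<Sum>k<2. b k * z ^ k))"
      using assms(3)[OF that] by (simp add: b_def numeral_2_eq_2)
    then show ?thesis by (rule sums_iff_shift'[THEN iffD1])
  qed
  have p0: "p 0 = 1"
    using \<open>q < 1\<close> by (simp add: p_def b_def)
  have coeff: "norm (h k) \<le> 1 + q" if "0 < k" for k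
  proof -
    have \<phi>0: "\<phi> 0 = - of_real q"
      by (simp add: \<phi>_def h_def shift_def p0)
    have "norm (\<phi> k) \<le> 1 - (norm (\<phi> 0))\<^sup>2"
    proof (rule bounded_coeff_bound)
      fix z :: complex assume z: "z \<in> ball 0 1"
      let ?p = "q_diff q f z"
      let ?\<phi> = "of_real (1 - q) * (?p - z * ?p + z * (z * ?p)) - 1"
      have p: "(\<lambda>k. p k * z ^ k) sums ?p"
        unfolding p_def by (rule q_diff_sums) (use assms(1,2) f_sums z in auto)
      have shift: "(\<lambda>k. shift u k * z ^ k) sums (z * s)" if "(\<lambda>k. u k * z ^ k) sums s" for u s
        unfolding shift_def by (rule sums_mult_var[OF that])
      have "(\<lambda>k. p k * z ^ k - shift p k * z ^ k + shift (shift p) k * z ^ k)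
          sums (?p - z * ?p + z * (z * ?p))"
        by (intro sums_add sums_diff p shift)
      then have "(\<lambda>k. h k * z ^ k) sums (?p - z * ?p + z * (z * ?p))"
        by (simp add: h_def algebra_simps)
      then have "(\<lambda>k. of_real (1 - q) * (h k * z ^ k) - (if k = 0 then 1 else 0) * z ^ k) sums ?\<phi>"
        using powser_sums_if[of 0 z] by (intro sums_diff sums_mult) auto
      then show "(\<lambda>k. \<phi> k * z ^ k) sums (of_real (1 - q) * ((1 - z + z\<^sup>2) * q_diff q f z) - 1)"
        by (simp add: \<phi>_def algebra_simps power2_eq_square)
      have weight: "id_over (\<lambda>z. z / (1 - z + z ^ 2)) z = 1 - z + z\<^sup>2"
        by (simp add: id_over_def)
      have "norm ((1 - z + z\<^sup>2) * ?p - 1 / (1 - of_real q)) \<le> 1 / (1 - q)"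
        using assms(4) z unfolding in_Kq_with_def weight[symmetric] by blast
      then have "(1 - q) * norm ((1 - z + z\<^sup>2) * ?p - 1 / (1 - of_real q)) \<le> 1"
        using \<open>q < 1\<close> by (simp add: field_simps)
      moreover have "(1 - q) * norm ((1 - z + z\<^sup>2) * ?p - 1 / (1 - of_real q))
          = norm (of_real (1 - q) * ((1 - z + z\<^sup>2) * ?p - 1 / (1 - of_real q)))"
        using \<open>q < 1\<close> by (simp only: norm_mult norm_of_real abs_of_pos diff_gt_0_iff_gt)
      moreover have "of_real (1 - q) * ((1 - z + z\<^sup>2) * ?p - 1 / (1 - of_real q))
          = of_real (1 - q) * ((1 - z + z\<^sup>2) * ?p) - 1"
        using \<open>q < 1\<close> by (simp add: right_diff_distrib)
      ultimately show "norm (of_real (1 - q) * ((1 - z + z\<^sup>2) * ?p) - 1) \<le> 1"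
        by simp
    qed (use \<phi>0 that assms(1,2) in auto)
    moreover have "norm (\<phi> k) = (1 - q) * norm (h k)"
      using that \<open>q < 1\<close> by (simp add: \<phi>_def norm_mult del: of_real_diff)
    ultimately have "(1 - q) * norm (h k) \<le> (1 - q) * (1 + q)"
      by (simp add: \<phi>0 algebra_simps power2_eq_square)
    with \<open>q < 1\<close> show ?thesis by simp
  qed
  have h1: "norm (p 1 - p 0) \<le> 1 + q"
    using coeff[of 1] by (simp add: h_def shift_def)
  have h2: "norm (p (k + 2) - p (k + 1) + p k) \<le> 1 + q" for k
    using coeff[of "k + 2"] by (simp add: h_def shift_def)
  have "norm (p 0) \<le> 1" by (simp add: p0)
  note p_bounds = mod3_recurrence_bounds[of p, OF this h1 h2]
  have a_le: "norm (a (Suc k)) \<le> (1 - q) / (1 - q ^ Suc k) * B" if "norm (p k) \<le> B" "0 < k" for k B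
  proof -
    have pos: "1 - q ^ Suc k > 0"
      using power_strict_decreasing[of 0 "Suc k" q] assms(1,2) by simp
    have "p k = a (Suc k) * of_real ((1 - q ^ Suc k) / (1 - q))"
      using \<open>0 < k\<close> by (simp add: p_def b_def)
    then have "norm (p k) = norm (a (Suc k)) * ((1 - q ^ Suc k) / (1 - q))"
      using pos \<open>q < 1\<close> by (simp only: norm_mult norm_of_real) simp
    with that(1) pos \<open>q < 1\<close> show ?thesis by (simp add: field_simps)
  qed
  \<comment> \<open>As \<open>a\<^sub>n\<close> corresponds to \<open>p\<^sub>n\<^sub>-\<^sub>1\<close>, the indices \<open>3 m - 1\<close> and \<open>3 m\<close> belong to the block
    of three numbered \<open>l = m - 1\<close>, while \<open>3 m + 1\<close> belongs to block \<open>m\<close>.\<close>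
  show ?thesis
  proof (intro allI impI conjI)
    fix m n :: nat assume "1 \<le> m"
    then obtain l where m: "m = Suc l" by (cases m) auto
    {
      assume n: "n = 3 * m - 1"
      then have n': "n = Suc (3 * l + 1)" by (simp add: m)
      have "1 + (2 * real l + 1) * (1 + q) = 1 / 3 * (2 - q) + 2 * real n / 3 * (1 + q)"
        by (simp add: n' field_simps)
      with a_le[OF p_bounds(2)[of l]] show
        "norm (a n) \<le> (1 - q) / (1 - q ^ n) * (1 / 3 * (2 - q) + 2 * real n / 3 * (1 + q))"
        unfolding n' by simp
    next
      assume n: "n = 3 * m"
      then have n': "n = Suc (3 * l + 2)" by (simp add: m)
      have size: "2 * real n / 3 = 2 * real l + 2"
        by (simp add: n')
      have "(1 - q) * (1 + q) = 1 - q ^ 2"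
        by (simp add: power2_eq_square algebra_simps)
      then have "(1 - q) / (1 - q ^ n) * ((2 * real l + 2) * (1 + q))
          = (1 - q ^ 2) / (1 - q ^ n) * (2 * real n / 3)"
        unfolding size by (metis mult.assoc mult.commute times_divide_eq_left)
      with a_le[OF p_bounds(3)[of l]] show
        "norm (a n) \<le> (1 - q ^ 2) / (1 - q ^ n) * (2 * real n / 3)"
        unfolding n' by simp
    next
      assume n: "n = 3 * m + 1"
      then have n': "n = Suc (3 * m)" by simp
      have "1 + 2 * real m * (1 + q) = 2 * real n / 3 * (1 + q) + 1 / 3 * (1 - 2 * q)"
        by (simp add: n' field_simps)
      with a_le[OF p_bounds(1)[of m]] show
        "norm (a n) \<le> (1 - q) / (1 - q ^ n) * (2 * real n / 3 * (1 + q) + 1 / 3 * (1 - 2 * q))"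
        unfolding n' using \<open>1 \<le> m\<close> by simp
    }
  qed
qed

end
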